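(* Let $f$ be a convex function and $x_0\in\operatorname{dom} f$. Denote $K=\{x: f(x)\le f(x_0)\}$ and assume that $f\in\mathcal{H}_{2,L}\cap\mathcal{L}_{r,\mu}(K)$. Put $\kappa = L/\mu^{2/r}$, $\tau = 1-2/r\in[0,1)$, $c=4e^{2/e}$. Run the restart scheme $x_k=\mathcal{A}(x_{k-1},t_k)$, $k=1,\dots,R$, from $x_0$ with iteration schedule $t_k=C^*_{\kappa,\tau}e^{\tau k}$, for $k=1,\dots,R$, where $$C^*_{\kappa,\tau} = e^{1-\tau}(c\kappa)^{1/2}(f(x_0)-f^* )^{-\tau/2}.$$ The precision reached at the last point $\hat x=x_R$ is given by $$f(\hat x)-f^*\le \exp\left(-2e^{-1}(c\kappa)^{-1/2}N\right)(f(x_0)-f^* )=O\left(\exp(-\kappa^{-1/2}N)\right),\quad\text{when }\tau=0,$$ while $$f(\hat x)-f^*\le \frac{f(x_0)-f^*}{\left(\tau e^{-1}(f(x_0)-f^* )^{\tau/2}(c\kappa)^{-1/2}N+1\right)^{2/\tau}}=O\left(N^{-2/\tau}\right),\quad\text{when }\tau>0,$$ where $N=\sum_{k=1}^R t_k$ is the total number of iterations.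
   Context: $f$ is defined on $\mathbb{R}^n$; $X^*$ is its set of minimizers and $f^*$ its minimum. $L>0$, $\mu>0$, $r\ge1$ are constants. $\mathcal{H}_{2,L}$ is the set of functions $f$ with $\|\nabla f(x)-\nabla f(y)\|_2\le L\|x-y\|_2$ for all $x,y\in\operatorname{dom} f$ and any subgradients $\nabla f(x)\in\partial f(x)$, $\nabla f(y)\in\partial f(y)$. $\mathcal{L}_{r,\mu}(K)$ is the set of functions $f$ satisfying the Łojasiewicz growth condition $\frac{\mu}{r}d(x,X^* )^r\le f(x)-f^*$ for every $x\in K$, where $d(x,X^* )=\min_{y\in X^*}\|x-y\|_2$. $\mathcal{A}$ denotes Nesterov's accelerated gradient method with monotone objective values: given a starting point $x$ and a number of iterations $t$ it outputs a point $\mathcal{A}(x,t)$ such that $f(\mathcal{A}(x,t))-f^*\le \frac{4L}{t^2}d(x,X^* )^2$ and $f(\mathcal{A}(x,t))\le f(x)$. Iteration counts $t_k$ are treated as real numbers (rounding to integers is ignored).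
   Formalization: For τ=0, the bound is stated as O(exp(-2e^{-1}c^{-1/2}κ^{-1/2}N)) instead of O(exp(-κ^{-1/2}N)), because 2e^{-1}c^{-1/2}≈0.25<1 makes the literal claim false whenever f(x_0)>f^*. *)

theory Defs
  imports "HOL-Analysis.Analysis" "HOL-Library.Landau_Symbols"
begin

definition minimizers :: "(real^'n \<Rightarrow> real) \<Rightarrow> (real^'n) set" where
  "minimizers f = {x. \<forall>y. f x \<le> f y}"

text \<open>This infimum is the minimum of \<open>f\<close> as soon as \<open>minimizers f\<close> is nonempty; otherwise it
  may be an unspecified real.\<close>

definition opt_val :: "(real^'n \<Rightarrow> real) \<Rightarrow> real" where
  "opt_val f = (INF x. f x)"

definition subdifferential :: "(real^'n \<Rightarrow> real) \<Rightarrow> real^'n \<Rightarrow> (real^'n) set" where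
  "subdifferential f x = {g. \<forall>y. f x + g \<bullet> (y - x) \<le> f y}"

definition smooth_class :: "real \<Rightarrow> (real^'n \<Rightarrow> real) set" where
  "smooth_class L = {f. \<forall>x y. \<forall>u \<in> subdifferential f x. \<forall>v \<in> subdifferential f y.
     norm (u - v) \<le> L * norm (x - y)}"

text \<open>For continuous \<open>f\<close> the set of minimizers is closed, so when it is nonempty the infimum
  in \<open>infdist\<close> is attained. For an empty set \<open>infdist\<close> is 0, so nonemptiness has to be
  assumed wherever this class is used.\<close>

definition lojasiewicz_class :: "real \<Rightarrow> real \<Rightarrow> (real^'n) set \<Rightarrow> (real^'n \<Rightarrow> real) set" where
  "lojasiewicz_class r \<mu> K = {f. \<forall>x \<in> K.
     \<mu> / r * infdist x (minimizers f) powr r \<le> f x - opt_val f}"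

text \<open>The accelerated method enters only through its guarantees; \<open>A x t\<close> is its output after
  \<open>t\<close> iterations from \<open>x\<close>, with real \<open>t\<close>. The rate is void for \<open>t = 0\<close>, where \<open>4 * L / t\<^sup>2\<close>
  stands for infinity but evaluates to 0 in HOL.\<close>

definition accelerated_method ::
    "(real^'n \<Rightarrow> real) \<Rightarrow> real \<Rightarrow> (real^'n \<Rightarrow> real \<Rightarrow> real^'n) \<Rightarrow> bool" where
  "accelerated_method f L A \<longleftrightarrow>
     (\<forall>x. \<forall>t>0. f (A x t) - opt_val f \<le> 4 * L / t\<^sup>2 * (infdist x (minimizers f))\<^sup>2) \<and>
     (\<forall>x. \<forall>t\<ge>0. f (A x t) \<le> f x)"

text \<open>\<open>\<Delta>\<close> is the initial gap. The case distinction encodes \<open>0\<^sup>0 = 1\<close>, since \<open>0 powr 0 = 0\<close> in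
  HOL. For \<open>\<Delta> = 0\<close> and \<open>\<tau> > 0\<close>, where the formula is undefined on paper, it yields 0.\<close>

definition schedule_const :: "real \<Rightarrow> real \<Rightarrow> real \<Rightarrow> real \<Rightarrow> real" where
  "schedule_const c \<kappa> \<tau> \<Delta> =
     exp (1 - \<tau>) * (c * \<kappa>) powr (1/2) * (if \<tau> = 0 then 1 else \<Delta> powr (- \<tau> / 2))"

primrec restart :: "('a \<Rightarrow> real \<Rightarrow> 'a) \<Rightarrow> (nat \<Rightarrow> real) \<Rightarrow> 'a \<Rightarrow> nat \<Rightarrow> 'a" where
  "restart A t x0 0 = x0"
| "restart A t x0 (Suc k) = A (restart A t x0 k) (t (Suc k))"

end

theory Submission imports Defs begin

text \<open>
  The accelerated rate combined with the growth condition gives, for the gap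
  \<open>d k = f (x k) - opt_val f\<close>, the recursion \<open>d (k + 1) \<le> c \<kappa> (d k) powr (1 - \<tau>) / (t (k + 1))\<^sup>2\<close>; the factor
  \<open>r powr (2 / r)\<close> produced on the way is maximal at \<open>r = e\<close>, which explains \<open>c\<close>. The schedule is
  chosen so that the recursion preserves \<open>d k \<le> exp (- 2 k) \<Delta>\<close>. Summing the geometric series and
  using \<open>\<tau> \<le> exp \<tau> - 1\<close> expresses this decay in terms of \<open>N\<close>.
\<close>

text \<open>The tangent bound \<open>ln u \<le> u - 1\<close> at \<open>u = r / exp 1\<close> gives
  \<open>ln r / r \<le> 1 / exp 1\<close>, with equality at \<open>r = exp 1\<close>.\<close>

lemma powr_two_div_self_le:
  fixes r :: real
  assumes "r > 0"
  shows "r powr (2 / r) \<le> exp (2 / exp 1)"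
proof -
  have "ln (r / exp 1) \<le> r / exp 1 - 1"
    using assms by (intro ln_le_minus_one) auto
  then have "ln r \<le> r / exp 1"
    using assms by (simp add: ln_div)
  then have "2 / r * ln r \<le> 2 / r * (r / exp 1)"
    using assms by (intro mult_left_mono) auto
  then show ?thesis
    using assms by (simp add: powr_def)
qed

lemma opt_val_le:
  assumes "minimizers f \<noteq> {}"
  shows "opt_val f \<le> f x"
proof -
  obtain z where "\<And>y. f z \<le> f y"
    using assms by (auto simp: minimizers_def)
  then have "bdd_below (range f)"
    by (intro bdd_belowI[of _ "f z"]) auto
  then show ?thesis
    unfolding opt_val_def by (rule cINF_lower) simp
qed

text \<open>The growth condition is solved for the distance. The power \<open>2 / r\<close> is
  chosen because the accelerated rate involves the squared distance.\<close>

lemma infdist_minimizers_le: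
  assumes "r > 0" "\<mu> > 0" "f \<in> lojasiewicz_class r \<mu> K" "y \<in> K"
  shows "(infdist y (minimizers f))\<^sup>2 \<le> (r / \<mu>) powr (2 / r) * (f y - opt_val f) powr (2 / r)"
proof -
  define D where "D = infdist y (minimizers f)"
  have D: "D \<ge> 0"
    by (simp add: D_def infdist_nonneg)
  have loj: "\<mu> / r * D powr r \<le> f y - opt_val f"
    using assms by (auto simp: lojasiewicz_class_def D_def)
  have gap: "0 \<le> f y - opt_val f"
    using loj assms by (intro order_trans[OF _ loj]) auto
  have "D powr r \<le> r / \<mu> * (f y - opt_val f)"
    using loj assms by (simp add: field_simps)
  then have "(D powr r) powr (2 / r) \<le> (r / \<mu> * (f y - opt_val f)) powr (2 / r)"
    using assms by (intro powr_mono2) auto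
  \<comment> \<open>At \<open>D = 0\<close> both sides vanish, by the convention
    \<open>0 powr a = 0\<close>.\<close>
  also have "(D powr r) powr (2 / r) = D\<^sup>2"
    using assms D by (cases "D = 0") (auto simp: powr_powr powr_numeral)
  finally show ?thesis
    using assms gap by (simp add: D_def powr_mult del: times_divide_eq_left)
qed

text \<open>Inserting the distance bound into the accelerated rate leaves the factor
  \<open>(r / \<mu>) powr (2 / r)\<close>: its \<open>\<mu>\<close> part completes the condition
  number \<open>L / \<mu> powr (2 / r)\<close>, its \<open>r\<close> part is absorbed into a
  constant free of \<open>r\<close>.\<close>

lemma accelerated_method_step:
  fixes f :: "real^'n \<Rightarrow> real"
  assumes "L > 0" "\<mu> > 0" "r > 0" "accelerated_method f L A"
    "f \<in> lojasiewicz_class r \<mu> K" "y \<in> K" "s > 0"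
  shows "f (A y s) - opt_val f
    \<le> 4 * exp (2 / exp 1) * (L / \<mu> powr (2 / r)) * (f y - opt_val f) powr (2 / r) / s\<^sup>2"
proof -
  let ?g = "(f y - opt_val f) powr (2 / r)"
  have "f (A y s) - opt_val f \<le> 4 * L / s\<^sup>2 * (infdist y (minimizers f))\<^sup>2"
    using assms by (auto simp: accelerated_method_def)
  also have "\<dots> \<le> 4 * L / s\<^sup>2 * ((r / \<mu>) powr (2 / r) * ?g)"
    using assms by (intro mult_left_mono infdist_minimizers_le[where K = K]) auto
  also have "\<dots> = 4 * L / s\<^sup>2 / \<mu> powr (2 / r) * ?g * r powr (2 / r)"
    using assms by (simp add: powr_divide)
  also have "\<dots> \<le> 4 * L / s\<^sup>2 / \<mu> powr (2 / r) * ?g * exp (2 / exp 1)"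
    using assms by (intro mult_left_mono powr_two_div_self_le) auto
  finally show ?thesis
    by (simp add: mult_ac)
qed

text \<open>Monotonicity keeps every iterate in the initial sublevel set, the only region where the
  growth condition is available.\<close>

lemma restart_le:
  assumes "accelerated_method f L A" "\<And>k. t k \<ge> 0"
  shows "f (restart A t x0 k) \<le> f x0"
proof (induction k)
  case (Suc k)
  have "f (A (restart A t x0 k) (t (Suc k))) \<le> f (restart A t x0 k)"
    using assms by (simp add: accelerated_method_def)
  then show ?case
    using Suc by simp
qed simp

text \<open>Under the induction hypothesis the numerator is at most
  \<open>b * exp (- 2 * (1 - \<tau>) * k) * D powr (1 - \<tau>)\<close>, while
  \<open>(t (Suc k))\<^sup>2\<close> equals
  \<open>b * exp (2 + 2 * \<tau> * k) * D powr (- \<tau>)\<close>. In the quotient all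
  \<open>\<tau>\<close> cancel and one more factor \<open>exp (- 2)\<close> appears.\<close>

lemma scheduled_recursion_decay:
  fixes d t :: "nat \<Rightarrow> real"
  assumes "b > 0" "D > 0" "\<tau> \<le> 1" "d 0 = D" "\<And>k. d k \<ge> 0"
    and step: "\<And>k. d (Suc k) \<le> b * d k powr (1 - \<tau>) / (t (Suc k))\<^sup>2"
    and t: "\<And>k. t k = exp (1 - \<tau>) * b powr (1/2) * D powr (- \<tau> / 2) * exp (\<tau> * real k)"
  shows "d k \<le> exp (- 2 * real k) * D"
proof (induction k)
  case 0
  then show ?case using assms by simp
next
  case (Suc k)
  have "(t (Suc k))\<^sup>2 = (exp (1 - \<tau>))\<^sup>2 * (b powr (1/2))\<^sup>2 * (D powr (- \<tau> / 2))\<^sup>2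
      * (exp (\<tau> * real (Suc k)))\<^sup>2"
    unfolding t by (simp only: power_mult_distrib)
  also have "\<dots> = exp (2 * (1 - \<tau>)) * b * exp (- \<tau> * ln D) * exp (2 * (\<tau> * real (Suc k)))"
    using assms(1,2) by (simp add: powr_def exp_of_nat_mult[symmetric] exp_double[symmetric])
  also have "\<dots> = b * exp (2 + 2 * \<tau> * real k - \<tau> * ln D)"
    by (simp add: algebra_simps exp_add exp_diff exp_minus divide_simps)
  finally have t2: "(t (Suc k))\<^sup>2 = b * exp (2 + 2 * \<tau> * real k - \<tau> * ln D)" .
  have "d (Suc k) \<le> b * d k powr (1 - \<tau>) / (t (Suc k))\<^sup>2"
    by (rule step)
  also have "\<dots> \<le> b * (exp (- 2 * real k) * D) powr (1 - \<tau>) / (t (Suc k))\<^sup>2"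
    using assms Suc by (intro divide_right_mono mult_left_mono powr_mono2) auto
  also have "\<dots> = exp ((1 - \<tau>) * (- 2 * real k + ln D)) / exp (2 + 2 * \<tau> * real k - \<tau> * ln D)"
    using assms(1,2) by (simp add: t2 powr_def ln_mult)
  also have "\<dots> = exp (- 2 * real (Suc k) + ln D)"
    unfolding exp_diff[symmetric] by (simp add: algebra_simps)
  also have "\<dots> = exp (- 2 * real (Suc k)) * D"
    using assms(2) by (simp only: exp_add exp_ln)
  finally show ?case .
qed

text \<open>The new summand contributes \<open>\<tau> * exp (\<tau> * R)\<close>, so the bound grows
  by the factor \<open>1 + \<tau> \<le> exp \<tau>\<close>. Induction avoids the closed form of the
  geometric series, which divides by \<open>exp \<tau> - 1\<close> and breaks down at
  \<open>\<tau> = 0\<close>.\<close>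

lemma sum_exp_le:
  fixes \<tau> :: real
  assumes "\<tau> \<ge> 0"
  shows "\<tau> * exp (- \<tau>) * (\<Sum>k=1..R. exp (\<tau> * real k)) + 1 \<le> exp (\<tau> * real R)"
proof (induction R)
  case (Suc R)
  have "\<tau> * exp (- \<tau>) * exp (\<tau> * real (Suc R)) = \<tau> * exp (\<tau> * real R)"
    by (simp add: algebra_simps exp_add exp_minus divide_simps)
  moreover have "(\<Sum>k=1..Suc R. exp (\<tau> * real k))
      = (\<Sum>k=1..R. exp (\<tau> * real k)) + exp (\<tau> * real (Suc R))"
    by simp
  ultimately have "\<tau> * exp (- \<tau>) * (\<Sum>k=1..Suc R. exp (\<tau> * real k)) + 1
      \<le> \<tau> * exp (\<tau> * real R) + exp (\<tau> * real R)"
    using Suc by (simp only: distrib_left)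
  moreover have "(1 + \<tau>) * exp (\<tau> * real R) \<le> exp \<tau> * exp (\<tau> * real R)"
    by (intro mult_right_mono exp_ge_add_one_self) simp
  ultimately show ?case
    by (simp add: algebra_simps exp_add)
qed simp

text \<open>The \<open>O\<close> bounds are taken along \<open>R\<close>. The factor
  \<open>2 * exp (-1) * c powr (-1/2)\<close> stays in the exponent: it is less than 1, so replacing
  it by 1 would claim a faster decay than the explicit bound provides.\<close>

theorem proposition2p2:
  fixes f :: "real^'n \<Rightarrow> real" and x0 :: "real^'n" and K :: "(real^'n) set"
    and A :: "real^'n \<Rightarrow> real \<Rightarrow> real^'n" and x :: "nat \<Rightarrow> real^'n"
    and L \<mu> r \<kappa> \<tau> c C \<Delta> :: real and t N :: "nat \<Rightarrow> real"
  assumes "L > 0" and "\<mu> > 0" and "r \<ge> 1"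
    and "convex_on UNIV f"
    and "minimizers f \<noteq> {}"
    and "K = {y. f y \<le> f x0}"
    and "f \<in> smooth_class L \<inter> lojasiewicz_class r \<mu> K"
    and "\<kappa> = L / \<mu> powr (2 / r)"
    and "\<tau> = 1 - 2 / r" and "\<tau> \<in> {0..<1}"
    and "c = 4 * exp (2 / exp 1)"
    and "\<Delta> = f x0 - opt_val f"
    and "accelerated_method f L A"
    and "C = schedule_const c \<kappa> \<tau> \<Delta>"
    and "\<And>k. t k = C * exp (\<tau> * real k)"
    and "x = restart A t x0"
    and "\<And>R. N R = (\<Sum>k=1..R. t k)"
  shows
    "(\<tau> = 0 \<longrightarrow>
        (\<forall>R. f (x R) - opt_val f \<le> exp (- 2 * exp (-1) * (c * \<kappa>) powr (-1/2) * N R) * \<Delta>) \<and>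
        (\<lambda>R. exp (- 2 * exp (-1) * (c * \<kappa>) powr (-1/2) * N R) * \<Delta>)
          \<in> O(\<lambda>R. exp (- (2 * exp (-1) * c powr (-1/2)) * \<kappa> powr (-1/2) * N R)) \<and>
        (\<lambda>R. f (x R) - opt_val f)
          \<in> O(\<lambda>R. exp (- (2 * exp (-1) * c powr (-1/2)) * \<kappa> powr (-1/2) * N R)))
     \<and>
     (\<tau> > 0 \<longrightarrow>
        (\<forall>R. f (x R) - opt_val f
           \<le> \<Delta> / (\<tau> * exp (-1) * \<Delta> powr (\<tau> / 2) * (c * \<kappa>) powr (-1/2) * N R + 1) powr (2 / \<tau>)) \<and>
        (\<lambda>R. \<Delta> / (\<tau> * exp (-1) * \<Delta> powr (\<tau> / 2) * (c * \<kappa>) powr (-1/2) * N R + 1) powr (2 / \<tau>))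
          \<in> O(\<lambda>R. N R powr (- 2 / \<tau>)) \<and>
        (\<lambda>R. f (x R) - opt_val f) \<in> O(\<lambda>R. N R powr (- 2 / \<tau>)))"
proof -
  define d where "d k = f (x k) - opt_val f" for k
  have \<kappa>: "\<kappa> > 0" and c: "c > 0"
    using assms(1,2) by (simp_all add: assms(8,11))
  have b: "c * \<kappa> > 0"
    using \<kappa> c by simp
  have \<tau>: "0 \<le> \<tau>" "\<tau> < 1"
    using assms(10) by auto
  have loj: "f \<in> lojasiewicz_class r \<mu> K"
    using assms(7) by simp
  have C: "C \<ge> 0"
    by (simp add: assms(14) schedule_const_def)
  have t: "t k \<ge> 0" for k
    using C by (simp add: assms(15))
  have d0: "d 0 = \<Delta>"
    by (simp add: d_def assms(12,16))
  have d_nonneg: "d k \<ge> 0" for k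
    using opt_val_le[OF assms(5)] by (simp add: d_def)
  have x_le: "f (x k) \<le> f x0" for k
    unfolding assms(16) using assms(13) t by (rule restart_le)
  have d_le: "d k \<le> \<Delta>" for k
    using x_le[of k] by (simp add: d_def assms(12))
  have \<Delta>: "\<Delta> \<ge> 0"
    using d0 d_nonneg[of 0] by simp
  have C_eq: "C = exp (1 - \<tau>) * (c * \<kappa>) powr (1/2) * \<Delta> powr (- \<tau> / 2)" if "\<Delta> > 0"
    using that by (simp add: assms(14) schedule_const_def)
  have decay: "d k \<le> exp (- 2 * real k) * \<Delta>" for k
  \<comment> \<open>If \<open>\<Delta> = 0\<close>, the schedule may be identically 0 and the rate
    void; monotonicity alone then keeps the gap at 0. Otherwise all \<open>t k\<close> are positive,
    as the one-step estimate demands.\<close>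
  proof (cases "\<Delta> = 0")
    case True
    then show ?thesis using d_le[of k] by simp
  next
    case False
    then have \<Delta>_pos: "\<Delta> > 0" using \<Delta> by simp
    have "C > 0"
      using \<Delta>_pos b \<kappa> c by (simp add: C_eq)
    then have t_pos: "t k > 0" for k
      by (simp add: assms(15))
    show ?thesis
    proof (rule scheduled_recursion_decay[where d = d and t = t and \<tau> = \<tau>, OF b \<Delta>_pos])
      fix k
      have "x (Suc k) = A (x k) (t (Suc k))"
        by (simp add: assms(16))
      moreover have "x k \<in> K"
        using x_le by (simp add: assms(6))
      moreover have "1 - \<tau> = 2 / r"
        by (simp add: assms(9))
      ultimately show "d (Suc k) \<le> c * \<kappa> * d k powr (1 - \<tau>) / (t (Suc k))\<^sup>2"
        using accelerated_method_step[OF assms(1,2) _ assms(13) loj, of "x k" "t (Suc k)"]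
          t_pos assms(3) by (simp add: d_def assms(8,11))
    qed (use \<tau> d0 d_nonneg C_eq[OF \<Delta>_pos] assms(15) in auto)
  qed
  have N_eq: "N R = C * (\<Sum>k=1..R. exp (\<tau> * real k))" for R
    by (simp add: assms(15,17) sum_distrib_left)
  have b_cancel: "(c * \<kappa>) powr (-1/2) * (c * \<kappa>) powr (1/2) = 1"
    using \<kappa> c by (simp add: powr_add[symmetric])
  have bigo_of_bound: "(\<lambda>R. f (x R) - opt_val f) \<in> O(h)"
    if "\<And>R. d R \<le> g R" "g \<in> O(h)" for g h :: "nat \<Rightarrow> real"
  proof (rule landau_o.big_trans[OF _ that(2)])
    have "norm (d R) \<le> 1 * norm (g R)" for R
      using that(1)[of R] d_nonneg[of R] by simp
    then show "(\<lambda>R. f (x R) - opt_val f) \<in> O(g)"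
      by (intro bigoI[of _ 1] always_eventually allI) (simp add: d_def)
  qed
  show ?thesis
  proof (intro conjI impI)
    assume \<tau>0: "\<tau> = 0"
    let ?g = "\<lambda>R. exp (- 2 * exp (-1) * (c * \<kappa>) powr (-1/2) * N R) * \<Delta>"
    \<comment> \<open>The schedule is constant here, so \<open>N R\<close> is proportional to
      \<open>R\<close> and the claimed bound is the decay estimate itself.\<close>
    have "- 2 * exp (-1) * (c * \<kappa>) powr (-1/2) * N R = - 2 * real R" for R
    proof -
      have "N R = exp 1 * (c * \<kappa>) powr (1/2) * real R"
        by (simp add: N_eq assms(14) schedule_const_def \<tau>0)
      then have "- 2 * exp (-1) * (c * \<kappa>) powr (-1/2) * N R
          = - 2 * (exp (-1) * exp 1) * ((c * \<kappa>) powr (-1/2) * (c * \<kappa>) powr (1/2)) * real R"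
        by (simp only: mult_ac)
      then show ?thesis
        unfolding b_cancel by (simp add: exp_add[symmetric])
    qed
    then have bound: "d R \<le> ?g R" for R
      using decay[of R] by (simp only:)
    then show "\<forall>R. f (x R) - opt_val f \<le> ?g R"
      by (simp add: d_def)
    have "?g = (\<lambda>R. exp (- (2 * exp (-1) * c powr (-1/2)) * \<kappa> powr (-1/2) * N R) * \<Delta>)"
      using c \<kappa> by (simp add: powr_mult mult_ac)
    then show bigo: "?g \<in> O(\<lambda>R. exp (- (2 * exp (-1) * c powr (-1/2)) * \<kappa> powr (-1/2) * N R))"
      by simp
    show "(\<lambda>R. f (x R) - opt_val f)
        \<in> O(\<lambda>R. exp (- (2 * exp (-1) * c powr (-1/2)) * \<kappa> powr (-1/2) * N R))"
      using bound bigo by (rule bigo_of_bound)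
  next
    assume \<tau>_pos: "\<tau> > 0"
    define a where "a = \<tau> * exp (-1) * \<Delta> powr (\<tau> / 2) * (c * \<kappa>) powr (-1/2)"
    let ?g = "\<lambda>R. \<Delta> / (a * N R + 1) powr (2 / \<tau>)"
    have a: "a \<ge> 0"
      using \<tau>_pos by (simp add: a_def)
    have N_nonneg: "N R \<ge> 0" for R
      using t by (simp add: assms(17) sum_nonneg)
    have bound: "d R \<le> ?g R" for R
    proof (cases "\<Delta> = 0")
      case True
      then show ?thesis using d_le[of R] by simp
    next
      case False
      then have \<Delta>_pos: "\<Delta> > 0" using \<Delta> by simp
      \<comment> \<open>The factor \<open>a\<close> undoes the constant \<open>C\<close> up to
        \<open>\<tau> * exp (- \<tau>)\<close>, which makes \<open>a * N R + 1\<close> the left side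
        of \<open>sum_exp_le\<close>.\<close>
      have "a * N R = \<tau> * (exp (-1) * exp (1 - \<tau>)) * (\<Delta> powr (\<tau> / 2) * \<Delta> powr (- \<tau> / 2))
          * ((c * \<kappa>) powr (-1/2) * (c * \<kappa>) powr (1/2)) * (\<Sum>k=1..R. exp (\<tau> * real k))"
        by (simp only: a_def N_eq C_eq[OF \<Delta>_pos] mult_ac)
      also have "\<dots> = \<tau> * exp (- \<tau>) * (\<Sum>k=1..R. exp (\<tau> * real k))"
        unfolding b_cancel using \<Delta>_pos by (simp add: powr_add[symmetric] exp_add[symmetric])
      finally have "a * N R + 1 \<le> exp (\<tau> * real R)"
        using sum_exp_le[OF \<tau>(1)] by simp
      then have "(a * N R + 1) powr (2 / \<tau>) \<le> exp (\<tau> * real R) powr (2 / \<tau>)"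
        using a N_nonneg[of R] \<tau>_pos by (intro powr_mono2) auto
      also have "\<dots> = exp (2 * real R)"
        using \<tau>_pos by (simp add: powr_def)
      finally have "\<Delta> / exp (2 * real R) \<le> ?g R"
        using \<Delta> a N_nonneg[of R] by (intro divide_left_mono) (auto simp: add_nonneg_eq_0_iff)
      then show ?thesis
        using decay[of R] by (simp add: exp_minus divide_inverse mult_ac)
    qed
    then show "\<forall>R. f (x R) - opt_val f
        \<le> \<Delta> / (\<tau> * exp (-1) * \<Delta> powr (\<tau> / 2) * (c * \<kappa>) powr (-1/2) * N R + 1) powr (2 / \<tau>)"
      by (simp add: d_def a_def)
    have bigo: "?g \<in> O(\<lambda>R. N R powr (- 2 / \<tau>))"
    proof (cases "\<Delta> = 0")
      case False
      then have \<Delta>_pos: "\<Delta> > 0" using \<Delta> by simp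
      have a_pos: "a > 0"
        using \<tau>_pos \<Delta>_pos c \<kappa> by (simp add: a_def)
      have C_pos: "C > 0"
        using \<Delta>_pos c \<kappa> by (simp add: C_eq)
      \<comment> \<open>The index 0 must be left out: \<open>N 0 = 0\<close> and
        \<open>0 powr (- 2 / \<tau>) = 0\<close>, whereas \<open>?g 0 = \<Delta> > 0\<close>. For
        \<open>R \<ge> 1\<close> dropping the summand 1 only increases the negative power.\<close>
      have "norm (?g R) \<le> \<Delta> * a powr (- 2 / \<tau>) * norm (N R powr (- 2 / \<tau>))" if "R \<ge> 1" for R
      proof -
        have N_pos: "N R > 0"
          unfolding N_eq using C_pos that by (intro mult_pos_pos sum_pos) auto
        have "(a * N R + 1) powr (- 2 / \<tau>) \<le> (a * N R) powr (- 2 / \<tau>)"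
          using a_pos N_pos \<tau>_pos by (intro powr_mono2') auto
        then have "\<Delta> * (a * N R + 1) powr (- 2 / \<tau>) \<le> \<Delta> * (a powr (- 2 / \<tau>) * N R powr (- 2 / \<tau>))"
          using \<Delta> a_pos N_pos by (intro mult_left_mono) (auto simp: powr_mult)
        moreover have "?g R = \<Delta> * (a * N R + 1) powr (- 2 / \<tau>)"
          by (simp add: powr_minus divide_inverse)
        ultimately show ?thesis
          using \<Delta> by (simp add: mult_ac)
      qed
      then show ?thesis
        by (intro bigoI[of _ "\<Delta> * a powr (- 2 / \<tau>)"] eventually_sequentiallyI[of 1])
    qed simp
    then show "(\<lambda>R. \<Delta> / (\<tau> * exp (-1) * \<Delta> powr (\<tau> / 2) * (c * \<kappa>) powr (-1/2) * N R + 1) powr (2 / \<tau>))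
        \<in> O(\<lambda>R. N R powr (- 2 / \<tau>))"
      by (simp add: a_def)
    show "(\<lambda>R. f (x R) - opt_val f) \<in> O(\<lambda>R. N R powr (- 2 / \<tau>))"
      using bound bigo by (rule bigo_of_bound)
  qed
qed

end
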